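(* Let $I=[-1,1]$ and let $n,p,s$ be (positive) integers such that $s\le\min(n/2,\,p)$. Let $\{1,u_1,\dots,u_n\}$ be a homogeneous $M$-system of real-valued continuous functions on $I$, and let $t_1,\dots,t_p$ be distinct points of $I$. Let $A\in\mathbb R^{(n+1)\times p}$ be the generalized Vandermonde matrix \[ A=\begin{pmatrix}1&1&\dots&1\\ u_1(t_1)&u_1(t_2)&\dots&u_1(t_p)\\ u_2(t_1)&u_2(t_2)&\dots&u_2(t_p)\\ \vdots&\vdots&&\vdots\\ u_n(t_1)&u_n(t_2)&\dots&u_n(t_p)\end{pmatrix}. \] Then basis pursuit exactly recovers all nonnegative $s$-sparse vectors $x_0\in\mathbb R^p$ from the observation $Ax_0$; that is, for every $x_0\in\mathbb R^p$ with nonnegative entries and at most $s$ nonzero entries, $x_0$ is the unique minimizer of $\|y\|_1$ over all $y\in\mathbb R^p$ with $Ay=Ax_0$.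
   Context: A set $\{u_0,\dots,u_k\}$ of continuous functions on $I$ is a $T$-system of degree $k$ if every $P=\sum_{l=0}^k a_l u_l$ with $(a_0,\dots,a_k)\ne(0,\dots,0)$ has at most $k$ zeros in $I$. The family $\{u_0,\dots,u_n\}$ is an $M$-system if $\{u_0,\dots,u_k\}$ is a $T$-system of degree $k$ for every $0\le k\le n$; it is homogeneous if moreover $u_0$ is a constant function (here $u_0=1$). Basis pursuit is the problem of minimizing the $\ell_1$-norm $\|y\|_1$ over $y\in\mathbb R^p$ subject to $Ay=Ax_0$. *)

theory Defs
  imports Complex_Main "Jordan_Normal_Form.Matrix"
begin

(* The number of zeros is the number of distinct zeros. Finiteness is required
   explicitly because card of an infinite set is 0. *)
definition T_system :: "real set \<Rightarrow> nat \<Rightarrow> (nat \<Rightarrow> real \<Rightarrow> real) \<Rightarrow> bool" where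
  "T_system I k u \<longleftrightarrow>
     (\<forall>l\<le>k. continuous_on I (u l)) \<and>
     (\<forall>a :: nat \<Rightarrow> real. (\<exists>l\<le>k. a l \<noteq> 0) \<longrightarrow>
        finite {x \<in> I. (\<Sum>l\<le>k. a l * u l x) = 0} \<and>
        card {x \<in> I. (\<Sum>l\<le>k. a l * u l x) = 0} \<le> k)"

definition M_system :: "real set \<Rightarrow> nat \<Rightarrow> (nat \<Rightarrow> real \<Rightarrow> real) \<Rightarrow> bool" where
  "M_system I n u \<longleftrightarrow> (\<forall>k\<le>n. T_system I k u)"

definition homogeneous_M_system :: "real set \<Rightarrow> nat \<Rightarrow> (nat \<Rightarrow> real \<Rightarrow> real) \<Rightarrow> bool" where
  "homogeneous_M_system I n u \<longleftrightarrow> M_system I n u \<and> (\<exists>c. \<forall>x\<in>I. u 0 x = c)"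

(* Row i holds the values of u i, so the row of ones is row 0 when u 0 = 1.
   The points are indexed from 0: t 0, ..., t (p - 1). *)
definition generalized_vandermonde ::
    "nat \<Rightarrow> nat \<Rightarrow> (nat \<Rightarrow> real \<Rightarrow> real) \<Rightarrow> (nat \<Rightarrow> real) \<Rightarrow> real mat" where
  "generalized_vandermonde n p u t = mat (n + 1) p (\<lambda>(i, j). u i (t j))"

definition l1_norm :: "real vec \<Rightarrow> real" where
  "l1_norm y = (\<Sum>i<dim_vec y. \<bar>y $ i\<bar>)"

definition nonneg_vec :: "real vec \<Rightarrow> bool" where
  "nonneg_vec x \<longleftrightarrow> (\<forall>i<dim_vec x. 0 \<le> x $ i)"

definition sparse_vec :: "nat \<Rightarrow> real vec \<Rightarrow> bool" where
  "sparse_vec s x \<longleftrightarrow> card {i. i < dim_vec x \<and> x $ i \<noteq> 0} \<le> s"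

definition basis_pursuit_feasible :: "real mat \<Rightarrow> real vec \<Rightarrow> real vec set" where
  "basis_pursuit_feasible A b = {y \<in> carrier_vec (dim_col A). A *\<^sub>v y = b}"

definition basis_pursuit_minimizers :: "real mat \<Rightarrow> real vec \<Rightarrow> real vec set" where
  "basis_pursuit_minimizers A b =
     {y \<in> basis_pursuit_feasible A b. \<forall>z \<in> basis_pursuit_feasible A b. l1_norm y \<le> l1_norm z}"

end

theory Submission
  imports Defs
begin

text \<open>
  Since the first row of the matrix consists of ones, a feasible vector whose norm does not
  exceed that of the nonnegative \<open>x0\<close> is itself nonnegative.  Its difference \<open>h\<close> to \<open>x0\<close> is
  therefore negative at \<open>s\<close> points \<open>t j\<close> at most.  Enclosing each of them in a short interval
  gives \<open>2 * s \<le> n\<close> cut points, and there is a generalized polynomial of the M-system that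
  changes sign precisely there, so that it has the sign of \<open>h j\<close> at every \<open>t j\<close>.  As \<open>h\<close>
  annihilates the system, \<open>h = 0\<close>.
\<close>

section \<open>Generalized polynomials: uniqueness and interpolation\<close>

definition gpoly :: "(nat \<Rightarrow> real \<Rightarrow> real) \<Rightarrow> nat \<Rightarrow> (nat \<Rightarrow> real) \<Rightarrow> real \<Rightarrow> real" where
  "gpoly u k c x = (\<Sum>l\<le>k. c l * u l x)"

lemma gpoly_linear:
  "gpoly u k (\<lambda>l. \<alpha> * c l + \<beta> * d l) x = \<alpha> * gpoly u k c x + \<beta> * gpoly u k d x"
  by (simp add: gpoly_def sum.distrib sum_distrib_left algebra_simps)

lemma gpoly_Suc_upd:
  "gpoly u (Suc k) (c(Suc k := \<gamma>)) x = gpoly u k c x + \<gamma> * u (Suc k) x"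
  by (simp add: gpoly_def)

lemma T_system_continuous_on_gpoly:
  assumes "T_system I k u"
  shows "continuous_on I (gpoly u k c)"
  using assms unfolding gpoly_def T_system_def by (intro continuous_intros) auto

lemma T_system_coeffs_eq_0:
  assumes "T_system I k u" "X \<subseteq> I" "k < card X" "\<And>x. x \<in> X \<Longrightarrow> gpoly u k c x = 0" "l \<le> k"
  shows "c l = 0"
proof (rule ccontr)
  let ?Z = "{x \<in> I. (\<Sum>l\<le>k. c l * u l x) = 0}"
  assume "c l \<noteq> 0"
  then have "finite ?Z" "card ?Z \<le> k"
    using assms(1,5) unfolding T_system_def by blast+
  moreover have "X \<subseteq> ?Z"
    using assms(2,4) by (auto simp: gpoly_def)
  ultimately show False
    using card_mono[of ?Z X] assms(3) by simp
qed

lemma T_system_gpoly_eq_0: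
  assumes "T_system I k u" "X \<subseteq> I" "k < card X" "\<And>x. x \<in> X \<Longrightarrow> gpoly u k c x = 0"
  shows "gpoly u k c y = 0"
  unfolding gpoly_def
  by (intro sum.neutral ballI) (simp add: T_system_coeffs_eq_0[OF assms])

text \<open>Induction on the degree in the manner of Newton: an interpolant \<open>p\<close> on all
  points but \<open>x\<close> is corrected by a multiple of \<open>u (Suc k) - q\<close>, where
  \<open>q\<close> has degree \<open>k\<close> and agrees with \<open>u (Suc k)\<close> on the old
  points. The correction vanishes there and not at \<open>x\<close>.\<close>

lemma M_system_interpolation:
  assumes "M_system I k u" "X \<subseteq> I" "card X = Suc k"
  shows "\<exists>c. \<forall>x\<in>X. gpoly u k c x = f x"
  using assms
proof (induction k arbitrary: X f)
  case 0
  then obtain x where x: "X = {x}"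
    by (metis One_nat_def card_1_singletonE)
  have "u 0 x \<noteq> 0"
    using T_system_coeffs_eq_0[of I 0 u X "\<lambda>_. 1" 0] 0 x by (auto simp: M_system_def gpoly_def)
  then show ?case
    using x by (intro exI[of _ "\<lambda>_. f x / u 0 x"]) (simp add: gpoly_def)
next
  case (Suc k)
  then obtain x X' where X: "X = insert x X'" "x \<notin> X'" "card X' = Suc k"
    by (metis card_Suc_eq)
  have M: "M_system I k u"
    using Suc.prems(1) by (simp add: M_system_def)
  obtain p where p: "\<And>y. y \<in> X' \<Longrightarrow> gpoly u k p y = f y"
    using Suc.IH[OF M, of X' f] X Suc.prems(2) by auto
  obtain q where q: "\<And>y. y \<in> X' \<Longrightarrow> gpoly u k q y = u (Suc k) y"
    using Suc.IH[OF M, of X' "u (Suc k)"] X Suc.prems(2) by auto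
  \<comment> \<open>Otherwise \<open>u (Suc k) - q\<close>, with leading coefficient 1, would vanish
    at all \<open>k + 2\<close> points of \<open>X\<close>.\<close>
  have ne: "u (Suc k) x - gpoly u k q x \<noteq> 0"
  proof
    assume 0: "u (Suc k) x - gpoly u k q x = 0"
    \<comment> \<open>The summand \<open>0 * q l\<close> only gives \<open>- q\<close> the shape
      that \<open>gpoly_linear\<close> expects.\<close>
    let ?c = "(\<lambda>l. - 1 * q l + 0 * q l)(Suc k := 1)"
    have "gpoly u (Suc k) ?c y = 0" if "y \<in> X" for y
      unfolding gpoly_Suc_upd gpoly_linear using that X q 0 by auto
    then have "?c (Suc k) = 0"
      using Suc.prems by (intro T_system_coeffs_eq_0[of I "Suc k" u X ?c]) (auto simp: M_system_def)
    then show False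
      by simp
  qed
  \<comment> \<open>The solution of \<open>gpoly u k p x + \<gamma> * (u (Suc k) x - gpoly u k q x)
    = f x\<close>.\<close>
  define \<gamma> where "\<gamma> = (f x - gpoly u k p x) / (u (Suc k) x - gpoly u k q x)"
  have "\<gamma> * (u (Suc k) x - gpoly u k q x) = f x - gpoly u k p x"
    using ne by (simp add: \<gamma>_def)
  then have "\<forall>y\<in>X. gpoly u (Suc k) ((\<lambda>l. 1 * p l + (- \<gamma>) * q l)(Suc k := \<gamma>)) y = f y"
    unfolding gpoly_Suc_upd gpoly_linear using X p q by (auto simp: algebra_simps)
  then show ?case
    by blast
qed

section \<open>Sign changes at a full set of zeros\<close>

text \<open>
  If there were no sign change at \<open>z\<close>, subtracting a small multiple of a generalized polynomial
  that is 1 at \<open>z\<close> and 0 at the other zeros would split \<open>z\<close> into two zeros, one too many.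
\<close>

lemma M_system_sign_change:
  fixes l r z :: real
  assumes M: "M_system {a..b} k u" and Z: "Z \<subseteq> {a..b}" "finite Z" "card Z = k" "z \<in> Z"
    and zero: "\<And>x. x \<in> Z \<Longrightarrow> gpoly u k c x = 0"
    and lr: "a \<le> l" "l < z" "z < r" "r \<le> b" "Z \<inter> {l..r} = {z}"
  shows "gpoly u k c l * gpoly u k c r \<le> 0"
proof (rule ccontr)
  assume "\<not> ?thesis"
  then have pos: "gpoly u k c l * gpoly u k c r > 0"
    by simp
  define \<sigma> where "\<sigma> = sgn (gpoly u k c l)"
  have posl: "\<sigma> * gpoly u k c l > 0" and posr: "\<sigma> * gpoly u k c r > 0"
    using pos by (auto simp: \<sigma>_def sgn_if zero_less_mult_iff)
  have T: "T_system {a..b} k u"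
    using M by (simp add: M_system_def)
  have "l \<notin> Z"
    using lr by auto
  \<comment> \<open>The set \<open>Z\<close> leaves one free node, spent on a zero at
    \<open>l\<close>: subtracting multiples of \<open>q\<close> then leaves the value at
    \<open>l\<close> alone, and only \<open>r\<close> limits \<epsilon>.\<close>
  then have "\<exists>q. \<forall>x\<in>insert l Z. gpoly u k q x = (if x = z then 1 else 0)"
    using Z lr by (intro M_system_interpolation[OF M]) auto
  then obtain q where q: "\<And>x. x \<in> insert l Z \<Longrightarrow> gpoly u k q x = (if x = z then 1 else 0)"
    by blast
  \<comment> \<open>Small enough to keep the difference positive at \<open>r\<close>; the summand 1
    keeps the denominator positive even if \<open>q\<close> vanishes at \<open>r\<close>.\<close>
  define \<epsilon> where "\<epsilon> = \<sigma> * gpoly u k c r / (1 + \<bar>gpoly u k q r\<bar>)"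
  have \<epsilon>: "\<epsilon> > 0"
    using posr by (simp add: \<epsilon>_def)
  have "\<epsilon> * gpoly u k q r \<le> \<epsilon> * \<bar>gpoly u k q r\<bar>"
    using \<epsilon> by (intro mult_left_mono) auto
  also have "\<dots> < \<epsilon> * (1 + \<bar>gpoly u k q r\<bar>)"
    using \<epsilon> by (simp add: algebra_simps)
  also have "\<dots> = \<sigma> * gpoly u k c r"
    by (simp add: \<epsilon>_def)
  finally have r: "\<epsilon> * gpoly u k q r < \<sigma> * gpoly u k c r" .
  define d where "d = (\<lambda>i. \<sigma> * c i + (- \<epsilon>) * q i)"
  have d: "gpoly u k d x = \<sigma> * gpoly u k c x - \<epsilon> * gpoly u k q x" for x
    unfolding d_def gpoly_linear by simp
  have dz: "gpoly u k d z < 0" and dl: "gpoly u k d l > 0" and dr: "gpoly u k d r > 0"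
    using r posl \<epsilon> lr Z by (auto simp: d q zero)
  have cont: "continuous_on S (gpoly u k d)" if "S \<subseteq> {a..b}" for S
    using T_system_continuous_on_gpoly[OF T] that by (rule continuous_on_subset)
  obtain v where v: "l \<le> v" "v \<le> z" "gpoly u k d v = 0"
    using IVT2'[of "gpoly u k d" z 0 l] dz dl lr cont[of "{l..z}"] by auto
  obtain w where w: "z \<le> w" "w \<le> r" "gpoly u k d w = 0"
    using IVT'[of "gpoly u k d" z 0 r] dz dr lr cont[of "{z..r}"] by auto
  have vw: "v < z" "z < w"
    using v w dz by (metis less_le)+
  \<comment> \<open>The zero \<open>z\<close> is traded for \<open>v\<close> and \<open>w\<close>,
    while the other \<open>k - 1\<close> points of \<open>Z\<close> remain zeros:
    \<open>k + 1\<close> in total.\<close>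
  let ?X = "insert v (insert w (Z - {z}))"
  have "v \<notin> Z" "w \<notin> Z"
    using vw v w lr by force+
  then have "card ?X = Suc k"
    using Z vw card_gt_0_iff[of Z] by (auto simp: card_insert_if)
  moreover have "gpoly u k d x = 0" if "x \<in> ?X" for x
    using that v w by (auto simp: d zero q)
  moreover have "?X \<subseteq> {a..b}"
    using v w vw lr Z by auto
  ultimately have "gpoly u k d z = 0"
    using T_system_gpoly_eq_0[OF T, of ?X d z] by simp
  then show False
    using dz by simp
qed

section \<open>From local signs to a global sign\<close>

text \<open>A punctured neighbourhood of \<open>x\<close> is also a neighbourhood of each of its
  points, since removing \<open>x\<close> from an open set leaves it open.\<close>

lemma eventually_at_within_eventually:
  fixes x :: "'a :: t1_space"
  assumes "eventually P (at x within I)"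
  shows "eventually (\<lambda>y. eventually P (at y within I)) (at x within I)"
proof -
  obtain S where S: "open S" "x \<in> S" "\<forall>y\<in>S. y \<noteq> x \<longrightarrow> y \<in> I \<longrightarrow> P y"
    using assms unfolding eventually_at_topological by auto
  have "eventually P (at y within I)" if "y \<in> S" "y \<noteq> x" for y
    unfolding eventually_at_topological
    using S that by (intro exI[of _ "S - {x}"]) (auto intro!: open_Diff)
  then show ?thesis
    unfolding eventually_at_topological using S by blast
qed

lemma at_within_Icc_neq_bot:
  fixes x :: real
  assumes "a < b" "x \<in> {a..b}"
  shows "at x within {a..b} \<noteq> bot"
proof -
  consider "x = a" | "x = b" | "a < x" "x < b"
    using assms by force
  then show ?thesis
    by cases (use assms in \<open>simp_all add: at_within_Icc_at_right at_within_Icc_at_left at_within_Icc_at\<close>)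
qed

text \<open>The sign of \<open>F\<close> near \<open>x\<close> is a locally constant function of
  \<open>x\<close>, hence constant on the connected interval. Punctured neighbourhoods are used so
  that \<open>F\<close> may vanish at isolated points.\<close>

lemma locally_constant_sign_imp_constant_sign:
  fixes F :: "real \<Rightarrow> real"
  assumes "a < b"
    and "\<And>x. x \<in> {a..b} \<Longrightarrow> eventually (\<lambda>y. F y > 0) (at x within {a..b})
                          \<or> eventually (\<lambda>y. F y < 0) (at x within {a..b})"
  shows "(\<forall>x\<in>{a..b}. eventually (\<lambda>y. F y > 0) (at x within {a..b}))
       \<or> (\<forall>x\<in>{a..b}. eventually (\<lambda>y. F y < 0) (at x within {a..b}))"
proof -
  let ?pos = "\<lambda>x. eventually (\<lambda>y. F y > 0) (at x within {a..b})"
  let ?neg = "\<lambda>x. eventually (\<lambda>y. F y < 0) (at x within {a..b})"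
  have excl: "\<not> (?pos x \<and> ?neg x)" if "x \<in> {a..b}" for x
  proof
    assume "?pos x \<and> ?neg x"
    then have "eventually (\<lambda>y. F y > 0 \<and> F y < 0) (at x within {a..b})"
      by (simp add: eventually_conj_iff)
    moreover have "(\<lambda>y. F y > 0 \<and> F y < 0) = (\<lambda>y. False)"
      by auto
    moreover have "at x within {a..b} \<noteq> bot"
      using at_within_Icc_neq_bot[OF assms(1) that] .
    ultimately show False
      by simp
  qed
  have "?pos x = ?pos y" if "x \<in> {a..b}" "y \<in> {a..b}" for x y
  proof (rule connected_local_const[OF connected_Icc that])
    show "\<forall>x\<in>{a..b}. eventually (\<lambda>y. ?pos x = ?pos y) (at x within {a..b})"
    proof
      fix x assume x: "x \<in> {a..b}"
      have "eventually (\<lambda>y. y \<in> {a..b}) (at x within {a..b})"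
        by (simp add: eventually_at_filter)
      moreover have "eventually ?pos (at x within {a..b}) \<or> eventually ?neg (at x within {a..b})"
        using assms(2)[OF x] eventually_at_within_eventually by blast
      ultimately show "eventually (\<lambda>y. ?pos x = ?pos y) (at x within {a..b})"
        using assms(2)[OF x] excl[OF x] eventually_at_within_eventually
        by (smt (verit, best) eventually_elim2 excl)
    qed
  qed
  then show ?thesis
    using assms(2) by blast
qed

text \<open>A polynomial whose degree equals the number of cut points inside the interval can be
  made to vanish exactly there, and by \<open>M_system_sign_change\<close> it changes sign at each
  of them. The product over \<open>W\<close> changes sign at the same points, so multiplying the two
  leaves a single sign, corrected by negation if necessary. Availability of every degree up to
  \<open>n\<close> is what the M-property provides.\<close>

lemma M_system_prescribed_signs:
  fixes a b :: real
  assumes M: "M_system {a..b} n u" and "a < b"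
    and W: "finite W" "card W \<le> n" "a \<notin> W" "b \<notin> W"
  shows "\<exists>k\<le>n. \<exists>c. \<forall>x\<in>{a..b} - W. gpoly u k c x * (\<Prod>w\<in>W. x - w) > 0"
proof -
  \<comment> \<open>A cut point outside the interval contributes a factor of constant sign and asks
    for no zero.\<close>
  define Z where "Z = W \<inter> {a..b}"
  define k where "k = card Z"
  have Z: "finite Z" "Z \<subseteq> {a<..<b}" "Z \<subseteq> W"
    using W by (force simp: Z_def less_le)+
  have k: "k \<le> n"
    using card_mono[OF W(1) Z(3)] W(2) by (simp add: k_def)
  have Mk: "M_system {a..b} k u"
    using M k by (simp add: M_system_def)
  then have T: "T_system {a..b} k u"
    by (simp add: M_system_def)
  have "a \<notin> Z"
    using W Z by auto
  \<comment> \<open>The value 1 at \<open>a\<close> makes the polynomial nontrivial; any zero beyond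
    \<open>Z\<close> would then be one too many.\<close>
  then have "\<exists>c. \<forall>x\<in>insert a Z. gpoly u k c x = (if x = a then 1 else 0)"
    using Z \<open>a < b\<close> by (intro M_system_interpolation[OF Mk]) (auto simp: k_def Z_def)
  then obtain c where c: "\<And>x. x \<in> insert a Z \<Longrightarrow> gpoly u k c x = (if x = a then 1 else 0)"
    by blast
  have zero: "gpoly u k c x = 0" if "x \<in> Z" for x
    using c \<open>a \<notin> Z\<close> that by auto
  have nonzero: "gpoly u k c x \<noteq> 0" if "x \<in> {a..b}" "x \<notin> Z" for x
  proof
    assume "gpoly u k c x = 0"
    then have "gpoly u k c a = 0"
      using that Z(1) zero T_system_gpoly_eq_0[OF T, of "insert x Z" c a]
      by (auto simp: k_def Z_def)
    then show False
      using c[of a] by simp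
  qed
  define F where "F x = gpoly u k c x * (\<Prod>w\<in>W. x - w)" for x
  have F_nonzero: "F x \<noteq> 0" if "x \<in> {a..b} - W" for x
    using that nonzero[of x] W(1) Z(3) by (auto simp: F_def)
  have cont: "continuous_on {a..b} F"
    unfolding F_def by (intro continuous_intros T_system_continuous_on_gpoly[OF T])
  have loc: "eventually (\<lambda>y. F y > 0) (at x within {a..b})
           \<or> eventually (\<lambda>y. F y < 0) (at x within {a..b})" if x: "x \<in> {a..b}" for x
  proof (cases "x \<in> W")
    case False
    have "(F \<longlongrightarrow> F x) (at x within {a..b})"
      using cont x by (simp add: continuous_on_def)
    moreover have "F x \<noteq> 0"
      using F_nonzero x False by simp
    ultimately show ?thesis
      by (metis linorder_neqE_linordered_idom order_tendstoD)
  next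
    case True
    then have "x \<in> Z"
      using x by (simp add: Z_def)
    \<comment> \<open>\<open>G\<close> collects the factors that do not vanish at \<open>x\<close>,
      so its sign is constant near \<open>x\<close> by continuity. In the remaining
      \<open>gpoly u k c y * (y - x)\<close> both factors change sign at \<open>x\<close>.\<close>
    define G where "G y = (\<Prod>w\<in>W-{x}. y - w)" for y
    have F_eq: "F y = (gpoly u k c y * (y - x)) * G y" for y
      using prod.remove[OF W(1) True, of "\<lambda>w. y - w"] by (simp add: F_def G_def)
    have "isCont G x"
      unfolding G_def by (intro continuous_intros)
    moreover have "G x \<noteq> 0"
      using W(1) by (auto simp: G_def)
    ultimately have G: "eventually (\<lambda>y. G y > 0) (at x) \<or> eventually (\<lambda>y. G y < 0) (at x)"
      unfolding isCont_def by (metis linorder_neqE_linordered_idom order_tendstoD)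
    have "open ({a<..<b} - (Z - {x}))" "x \<in> {a<..<b} - (Z - {x})"
      using Z \<open>x \<in> Z\<close> by (auto intro!: open_Diff finite_imp_closed)
    then obtain e where e: "e > 0" "\<And>y. dist y x < e \<Longrightarrow> y \<in> {a<..<b} - (Z - {x})"
      unfolding open_dist by blast
    have e': "y \<in> {a<..<b}" "y \<notin> Z - {x}" if "\<bar>y - x\<bar> < e" for y
      using e(2)[of y] that by (simp_all add: dist_real_def)
    have change: "gpoly u k c l * gpoly u k c r < 0" if "x - e < l" "l < x" "x < r" "r < x + e" for l r
    proof -
      have "Z \<inter> {l..r} = {x}"
        using e'(2) that \<open>x \<in> Z\<close> by (fastforce simp: abs_less_iff)
      moreover have "l \<in> {a<..<b}" "r \<in> {a<..<b}" "l \<notin> Z" "r \<notin> Z"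
        using e'[of l] e'[of r] that by auto
      moreover have "Z \<subseteq> {a..b}"
        by (simp add: Z_def)
      ultimately have "gpoly u k c l * gpoly u k c r \<le> 0"
        using that Z(1) \<open>x \<in> Z\<close> zero
        by (intro M_system_sign_change[OF Mk, of Z x c l r]) (auto simp: k_def)
      moreover have "gpoly u k c l \<noteq> 0" "gpoly u k c r \<noteq> 0"
        using nonzero \<open>l \<in> {a<..<b}\<close> \<open>r \<in> {a<..<b}\<close> \<open>l \<notin> Z\<close> \<open>r \<notin> Z\<close> by auto
      ultimately show ?thesis
        by (simp add: less_le)
    qed
    have "(\<forall>y. y \<noteq> x \<longrightarrow> \<bar>y - x\<bar> < e \<longrightarrow> gpoly u k c y * (y - x) > 0)
        \<or> (\<forall>y. y \<noteq> x \<longrightarrow> \<bar>y - x\<bar> < e \<longrightarrow> gpoly u k c y * (y - x) < 0)"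
    proof -
      let ?l = "x - e / 2" and ?r = "x + e / 2"
      have lr: "gpoly u k c ?l * gpoly u k c ?r < 0"
        using change e(1) by auto
      \<comment> \<open>\<open>?r\<close> serves as reference point. A point left of
        \<open>x\<close> is opposite in sign to \<open>?r\<close>; a point right of \<open>x\<close>
        and \<open>?r\<close> are both opposite to \<open>?l\<close>.\<close>
      have "gpoly u k c y * (y - x) * gpoly u k c ?r > 0" if "y \<noteq> x" "\<bar>y - x\<bar> < e" for y
      proof (cases "y < x")
        case True
        then have "gpoly u k c y * gpoly u k c ?r < 0"
          using change[of y ?r] that e(1) by auto
        then show ?thesis
          using True mult_neg_neg[of "gpoly u k c y * gpoly u k c ?r" "y - x"] by (simp add: ac_simps)
      next
        case False
        then have "gpoly u k c ?l * gpoly u k c y < 0"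
          using change[of ?l y] that e(1) by auto
        then have "gpoly u k c y * gpoly u k c ?r > 0"
          using lr by (auto simp: mult_less_0_iff zero_less_mult_iff)
        then show ?thesis
          using False that(1) mult_pos_pos[of "gpoly u k c y * gpoly u k c ?r" "y - x"]
          by (simp add: ac_simps)
      qed
      then show ?thesis
        by (cases "gpoly u k c ?r > 0") (meson zero_less_mult_iff not_less_iff_gr_or_eq)+
    qed
    then have "eventually (\<lambda>y. gpoly u k c y * (y - x) > 0) (at x)
             \<or> eventually (\<lambda>y. gpoly u k c y * (y - x) < 0) (at x)"
      unfolding eventually_at dist_real_def using e(1) by blast
    then have "eventually (\<lambda>y. F y > 0) (at x) \<or> eventually (\<lambda>y. F y < 0) (at x)"
      using G
    proof (elim disjE)
      assume "eventually (\<lambda>y. gpoly u k c y * (y - x) > 0) (at x)" "eventually (\<lambda>y. G y > 0) (at x)"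
      then have "eventually (\<lambda>y. F y > 0) (at x)"
        unfolding F_eq by eventually_elim (rule mult_pos_pos)
      then show ?thesis ..
    next
      assume "eventually (\<lambda>y. gpoly u k c y * (y - x) > 0) (at x)" "eventually (\<lambda>y. G y < 0) (at x)"
      then have "eventually (\<lambda>y. F y < 0) (at x)"
        unfolding F_eq by eventually_elim (rule mult_pos_neg)
      then show ?thesis ..
    next
      assume "eventually (\<lambda>y. gpoly u k c y * (y - x) < 0) (at x)" "eventually (\<lambda>y. G y > 0) (at x)"
      then have "eventually (\<lambda>y. F y < 0) (at x)"
        unfolding F_eq by eventually_elim (rule mult_neg_pos)
      then show ?thesis ..
    next
      assume "eventually (\<lambda>y. gpoly u k c y * (y - x) < 0) (at x)" "eventually (\<lambda>y. G y < 0) (at x)"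
      then have "eventually (\<lambda>y. F y > 0) (at x)"
        unfolding F_eq by eventually_elim (rule mult_neg_neg)
      then show ?thesis ..
    qed
    then show ?thesis
      using filter_leD[OF at_le[OF subset_UNIV]] by blast
  qed
  have "(\<forall>x\<in>{a..b} - W. F x > 0) \<or> (\<forall>x\<in>{a..b} - W. F x < 0)"
  proof -
    have limit: "(F \<longlongrightarrow> F x) (at x within {a..b})" "at x within {a..b} \<noteq> bot"
      if "x \<in> {a..b}" for x
      using cont that at_within_Icc_neq_bot[OF \<open>a < b\<close>] by (auto simp: continuous_on_def)
    \<comment> \<open>By continuity the sign near \<open>x\<close> passes to \<open>x\<close> as a
      weak inequality, which is strict because \<open>F x\<close> is nonzero off
      \<open>W\<close>.\<close>
    have "F x > 0" if "x \<in> {a..b} - W" "eventually (\<lambda>y. F y > 0) (at x within {a..b})" for x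
      using tendsto_lowerbound[OF limit(1) eventually_mono[OF that(2)], of 0] limit(2)
        F_nonzero[OF that(1)] that(1) by (auto simp: less_le)
    moreover have "F x < 0" if "x \<in> {a..b} - W" "eventually (\<lambda>y. F y < 0) (at x within {a..b})" for x
      using tendsto_upperbound[OF limit(1) eventually_mono[OF that(2)], of 0] limit(2)
        F_nonzero[OF that(1)] that(1) by (auto simp: less_le)
    ultimately show ?thesis
      using locally_constant_sign_imp_constant_sign[OF \<open>a < b\<close> loc] by blast
  qed
  then show ?thesis
  proof
    assume "\<forall>x\<in>{a..b} - W. F x > 0"
    then show ?thesis
      using k unfolding F_def by blast
  next
    assume "\<forall>x\<in>{a..b} - W. F x < 0"
    then have "\<forall>x\<in>{a..b} - W. gpoly u k (\<lambda>l. - 1 * c l + 0 * c l) x * (\<Prod>w\<in>W. x - w) > 0"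
      unfolding gpoly_linear F_def by simp
    then show ?thesis
      using k by blast
  qed
qed

section \<open>Separating finitely many points by sign\<close>

lemma finite_set_separation:
  fixes X :: "real set"
  assumes "finite X"
  shows "\<exists>d>0. \<forall>x\<in>X. \<forall>y\<in>X. x \<noteq> y \<longrightarrow> d \<le> \<bar>x - y\<bar>"
proof -
  \<comment> \<open>The element 1 keeps the minimum meaningful when \<open>X\<close> has fewer than
    two points.\<close>
  let ?D = "insert 1 ((\<lambda>(x, y). \<bar>x - y\<bar>) ` {(x, y) \<in> X \<times> X. x \<noteq> y})"
  have "finite {(x, y) \<in> X \<times> X. x \<noteq> y}"
    by (rule finite_subset[OF _ finite_cartesian_product[OF assms assms]]) auto
  then have D: "finite ?D"
    by simp
  then have "Min ?D > 0"
    by (subst Min_gr_iff) auto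
  moreover have "Min ?D \<le> \<bar>x - y\<bar>" if "x \<in> X" "y \<in> X" "x \<noteq> y" for x y
    using D that by (intro Min_le) auto
  ultimately show ?thesis
    by blast
qed

text \<open>Each \<open>y\<close> in \<open>N\<close> gets the cut points
  \<open>y - \<delta>\<close> and \<open>y + \<delta>\<close>. Their joint factor
  \<open>(x - y)\<^sup>2 - \<delta>\<^sup>2\<close> is negative at \<open>x = y\<close> and positive
  at every other point of \<open>X\<close>.\<close>

lemma M_system_separation:
  fixes a b :: real
  assumes M: "M_system {a..b} n u" and "a < b"
    and X: "finite X" "X \<subseteq> {a..b}" and N: "N \<subseteq> X" "2 * card N \<le> n"
  shows "\<exists>k\<le>n. \<exists>c. \<forall>x\<in>X. if x \<in> N then gpoly u k c x < 0 else gpoly u k c x > 0"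
proof -
  \<comment> \<open>The endpoints join the separated set because no cut point may equal
    \<open>a\<close> or \<open>b\<close>. If \<open>y\<close> is itself an endpoint, one of its cut
    points falls outside the interval.\<close>
  obtain d where d: "d > 0"
    "\<And>x y. x \<in> insert a (insert b X) \<Longrightarrow> y \<in> insert a (insert b X) \<Longrightarrow> x \<noteq> y \<Longrightarrow> d \<le> \<bar>x - y\<bar>"
    using finite_set_separation[of "insert a (insert b X)"] X(1) by (metis finite_insert)
  \<comment> \<open>With a third of the separation, cut points of different \<open>y\<close> stay
    distinct, being moved by at most \<open>2 * \<delta>\<close> towards each other.\<close>
  define \<delta> where "\<delta> = d / 3"
  have \<delta>: "\<delta> > 0"
    using d(1) by (simp add: \<delta>_def)
  have sep: "3 * \<delta> \<le> \<bar>x - y\<bar>" if "x \<in> insert a (insert b X)" "y \<in> N" "x \<noteq> y" for x y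
    using d(2)[of x y] that N(1) by (auto simp: \<delta>_def)
  have far: "x \<noteq> y - \<delta>" "x \<noteq> y + \<delta>" if "x \<in> insert a (insert b X)" "y \<in> N" for x y
    using sep[OF that] \<delta> by (cases "x = y"; force)+
  have finN: "finite N"
    using N(1) X(1) by (rule finite_subset)
  define W where "W = (\<lambda>y. y - \<delta>) ` N \<union> (\<lambda>y. y + \<delta>) ` N"
  have disj: "(\<lambda>y. y - \<delta>) ` N \<inter> (\<lambda>y. y + \<delta>) ` N = {}"
  proof -
    have "x - \<delta> \<noteq> y + \<delta>" if "x \<in> N" "y \<in> N" for x y
      using sep[of x y] that \<delta> N(1) by (cases "x = y") force+
    then show ?thesis
      by blast
  qed
  have W: "finite W" "card W \<le> n" "x \<notin> W" if "x \<in> insert a (insert b X)" for x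
    using finN N(2) card_image_le[OF finN, of "\<lambda>y. y - \<delta>"] card_image_le[OF finN, of "\<lambda>y. y + \<delta>"]
      card_Un_le[of "(\<lambda>y. y - \<delta>) ` N" "(\<lambda>y. y + \<delta>) ` N"] far[OF that]
    by (auto simp: W_def)
  have prod_W: "(\<Prod>w\<in>W. x - w) = (\<Prod>y\<in>N. (x - y)\<^sup>2 - \<delta>\<^sup>2)" for x
  proof -
    have "(\<Prod>w\<in>W. x - w) = (\<Prod>y\<in>N. x - (y - \<delta>)) * (\<Prod>y\<in>N. x - (y + \<delta>))"
      unfolding W_def using finN disj
      by (subst prod.union_disjoint) (auto simp: prod.reindex inj_on_def)
    also have "\<dots> = (\<Prod>y\<in>N. (x - y)\<^sup>2 - \<delta>\<^sup>2)"
      unfolding prod.distrib[symmetric]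
      by (intro prod.cong refl) (simp add: power2_eq_square algebra_simps)
    finally show ?thesis .
  qed
  have factor: "(x - y)\<^sup>2 - \<delta>\<^sup>2 > 0" if "x \<in> X" "y \<in> N" "x \<noteq> y" for x y
  proof -
    have "\<delta> < \<bar>x - y\<bar>"
      using sep[of x y] that \<delta> by auto
    then show ?thesis
      using power_strict_mono[of \<delta> "\<bar>x - y\<bar>" 2] \<delta> by simp
  qed
  have pos: "(\<Prod>w\<in>W. x - w) > 0" if "x \<in> X" "x \<notin> N" for x
    unfolding prod_W using that by (intro prod_pos factor) auto
  have neg: "(\<Prod>w\<in>W. x - w) < 0" if "x \<in> N" for x
  proof -
    have "(\<Prod>y\<in>N-{x}. (x - y)\<^sup>2 - \<delta>\<^sup>2) > 0"
      using that N(1) by (intro prod_pos factor) auto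
    then show ?thesis
      unfolding prod_W prod.remove[OF finN that] using \<delta> by (simp add: mult_less_0_iff)
  qed
  have "\<exists>k\<le>n. \<exists>c. \<forall>x\<in>{a..b} - W. gpoly u k c x * (\<Prod>w\<in>W. x - w) > 0"
    using W[of a] W[of b] by (intro M_system_prescribed_signs[OF M \<open>a < b\<close>]) auto
  then obtain k c where kc: "k \<le> n"
    "\<And>x. x \<in> {a..b} - W \<Longrightarrow> gpoly u k c x * (\<Prod>w\<in>W. x - w) > 0"
    by blast
  have "if x \<in> N then gpoly u k c x < 0 else gpoly u k c x > 0" if "x \<in> X" for x
    using kc(2)[of x] pos[of x] neg[of x] that X(2) W(3)[of x]
    by (auto simp: zero_less_mult_iff)
  then show ?thesis
    using kc(1) by blast
qed

section \<open>Annihilators of the system and exact recovery\<close>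

text \<open>Pairing \<open>h\<close> with a polynomial that is negative exactly where
  \<open>h\<close> is gives a sum of nonnegative terms equal to 0. Every term vanishes, and the
  polynomial is nonzero at every node, including those where \<open>h\<close> is 0.\<close>

lemma M_system_annihilator_eq_0:
  fixes a b :: real and h :: "'a \<Rightarrow> real"
  assumes M: "M_system {a..b} n u" and "a < b"
    and t: "finite J" "inj_on t J" "t ` J \<subseteq> {a..b}"
    and few: "2 * card {j \<in> J. h j < 0} \<le> n"
    and ann: "\<And>l. l \<le> n \<Longrightarrow> (\<Sum>j\<in>J. h j * u l (t j)) = 0"
    and "j \<in> J"
  shows "h j = 0"
proof -
  let ?N = "t ` {j \<in> J. h j < 0}"
  have "card ?N \<le> card {j \<in> J. h j < 0}"
    using t(1) by (intro card_image_le) auto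
  then obtain k c where k: "k \<le> n" and
    c: "\<forall>x\<in>t ` J. if x \<in> ?N then gpoly u k c x < 0 else gpoly u k c x > 0"
    using M_system_separation[OF M \<open>a < b\<close>, of "t ` J" ?N] t few by auto
  have sign: "if h i < 0 then gpoly u k c (t i) < 0 else gpoly u k c (t i) > 0" if "i \<in> J" for i
  proof -
    have "t i \<in> ?N \<longleftrightarrow> h i < 0"
      using t(2) that by (auto simp: inj_on_def)
    then show ?thesis
      using c that by auto
  qed
  have "(\<Sum>i\<in>J. h i * gpoly u k c (t i)) = (\<Sum>i\<in>J. \<Sum>l\<le>k. c l * (h i * u l (t i)))"
    by (simp add: gpoly_def sum_distrib_left algebra_simps)
  also have "\<dots> = (\<Sum>l\<le>k. c l * (\<Sum>i\<in>J. h i * u l (t i)))"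
    by (subst sum.swap) (simp add: sum_distrib_left)
  also have "\<dots> = 0"
    using ann k by (intro sum.neutral) auto
  finally have "(\<Sum>i\<in>J. h i * gpoly u k c (t i)) = 0" .
  moreover have "h i * gpoly u k c (t i) \<ge> 0" if "i \<in> J" for i
    using sign[OF that] by (auto simp: zero_le_mult_iff split: if_splits)
  ultimately have "h j * gpoly u k c (t j) = 0"
    using t(1) \<open>j \<in> J\<close> by (simp add: sum_nonneg_eq_0_iff)
  then show ?thesis
    using sign[OF \<open>j \<in> J\<close>] by (auto split: if_splits)
qed

lemma generalized_vandermonde_mult_vec_nth:
  assumes "y \<in> carrier_vec p" "l \<le> n"
  shows "(generalized_vandermonde n p u t *\<^sub>v y) $ l = (\<Sum>j<p. u l (t j) * y $ j)"
  using assms by (simp add: generalized_vandermonde_def scalar_prod_def atLeast0LessThan)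

theorem theorem2p4:
  fixes n p s :: nat and u :: "nat \<Rightarrow> real \<Rightarrow> real" and t :: "nat \<Rightarrow> real"
  assumes "0 < n" and "0 < p" and "0 < s"
    and "real s \<le> min (real n / 2) (real p)"
    and "homogeneous_M_system {-1..1} n u"
    and "\<forall>x\<in>{-1..1}. u 0 x = 1"
    and "\<forall>j<p. t j \<in> {-1..1}"
    and "inj_on t {..<p}"
  shows "\<forall>x0 \<in> carrier_vec p. nonneg_vec x0 \<and> sparse_vec s x0 \<longrightarrow>
           basis_pursuit_minimizers (generalized_vandermonde n p u t)
             (generalized_vandermonde n p u t *\<^sub>v x0) = {x0}"
proof (intro ballI impI)
  fix x0 assume x0: "x0 \<in> carrier_vec p" "nonneg_vec x0 \<and> sparse_vec s x0"
  let ?A = "generalized_vandermonde n p u t"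
  let ?feasible = "basis_pursuit_feasible ?A (?A *\<^sub>v x0)"
  have dim: "dim_vec x0 = p"
    using x0(1) by simp
  have nonneg: "x0 $ j \<ge> 0" if "j < p" for j
    using x0(2) dim that by (simp add: nonneg_vec_def)
  have mem: "y \<in> ?feasible \<longleftrightarrow> y \<in> carrier_vec p \<and> ?A *\<^sub>v y = ?A *\<^sub>v x0" for y
    by (simp add: basis_pursuit_feasible_def generalized_vandermonde_def)
  have moments: "(\<Sum>j<p. u l (t j) * y $ j) = (\<Sum>j<p. u l (t j) * x0 $ j)"
    if "y \<in> ?feasible" "l \<le> n" for y l
    using that x0(1) mem generalized_vandermonde_mult_vec_nth[of y p l n u t]
      generalized_vandermonde_mult_vec_nth[of x0 p l n u t] by simp
  \<comment> \<open>Row 0 consists of ones, so feasibility fixes the sum of the entries.\<close>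
  have total: "(\<Sum>j<p. y $ j) = (\<Sum>j<p. x0 $ j)" if "y \<in> ?feasible" for y
    using moments[OF that, of 0] assms(6,7) by simp
  have norm_x0: "l1_norm x0 = (\<Sum>j<p. x0 $ j)"
    using nonneg by (simp add: l1_norm_def dim)
  have norm: "l1_norm y = (\<Sum>j<p. \<bar>y $ j\<bar>)" if "y \<in> ?feasible" for y
    using that mem by (auto simp: l1_norm_def)
  have minimal: "l1_norm x0 \<le> l1_norm y" if "y \<in> ?feasible" for y
    unfolding norm_x0 total[OF that, symmetric] norm[OF that] by (intro sum_mono) auto
  have unique: "y = x0" if y: "y \<in> ?feasible" and le: "l1_norm y \<le> l1_norm x0" for y
  proof (rule eq_vecI)
    \<comment> \<open>The entry sum of \<open>y\<close> equals the norm of \<open>x0\<close>, so the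
      nonnegative gaps between \<open>\<bar>y $ j\<bar>\<close> and \<open>y $ j\<close> add up to 0
      and each of them vanishes.\<close>
    have "(\<Sum>j<p. \<bar>y $ j\<bar> - y $ j) \<le> 0"
      using le norm[OF y] norm_x0 total[OF y] by (simp add: sum_subtractf)
    moreover have "(\<Sum>j<p. \<bar>y $ j\<bar> - y $ j) \<ge> 0"
      by (intro sum_nonneg) auto
    ultimately have "(\<Sum>j<p. \<bar>y $ j\<bar> - y $ j) = 0"
      by simp
    then have "\<forall>j<p. \<bar>y $ j\<bar> - y $ j = 0"
      by (subst (asm) sum_nonneg_eq_0_iff) auto
    then have y_nonneg: "y $ j \<ge> 0" if "j < p" for j
      using that by force
    \<comment> \<open>Off the support of \<open>x0\<close> the difference is \<open>y $ j\<close>,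
      which is nonnegative.\<close>
    have "{j \<in> {..<p}. y $ j - x0 $ j < 0} \<subseteq> {j. j < dim_vec x0 \<and> x0 $ j \<noteq> 0}"
      using y_nonneg by (fastforce simp: dim)
    then have "card {j \<in> {..<p}. y $ j - x0 $ j < 0} \<le> card {j. j < dim_vec x0 \<and> x0 $ j \<noteq> 0}"
      by (intro card_mono) auto
    also have "\<dots> \<le> s"
      using x0(2) by (simp add: sparse_vec_def)
    finally have "2 * card {j \<in> {..<p}. y $ j - x0 $ j < 0} \<le> n"
      using assms(4) by linarith
    moreover have "(\<Sum>j<p. (y $ j - x0 $ j) * u l (t j)) = 0" if "l \<le> n" for l
      using moments[OF y that] by (simp add: algebra_simps sum_subtractf)
    moreover have "M_system {-1..1} n u"
      using assms(5) by (simp add: homogeneous_M_system_def)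
    ultimately have "y $ j - x0 $ j = 0" if "j < p" for j
      using that assms(7,8)
      by (intro M_system_annihilator_eq_0[of "-1" 1 n u "{..<p}" t "\<lambda>j. y $ j - x0 $ j"]) auto
    then show "y $ j = x0 $ j" if "j < dim_vec x0" for j
      using that dim by simp
    show "dim_vec y = dim_vec x0"
      using y mem dim by auto
  qed
  have "x0 \<in> ?feasible"
    using mem x0(1) by simp
  then show "basis_pursuit_minimizers ?A (?A *\<^sub>v x0) = {x0}"
    unfolding basis_pursuit_minimizers_def using minimal unique by blast
qed

end
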